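(* Every non-empty second-countable compact $\mathsf{T}_1$ space $X$ is (homeomorphic to) the spectrum of an edge-witnessing sequence in $\mathbf{B}$. Moreover, if $X$ is perfect (has no isolated points), respectively Hausdorff, the sequence can be chosen to be additionally anti-injective, respectively star-refining.
   Context: A graph is a finite non-empty set $G$ with a reflexive symmetric relation $\sqcap$ (the edge relation). A relation $R\subseteq H\times G$ between graphs is viewed as a relation from $G$ to $H$; write $R(g)=\{h:(h,g)\in R\}$ and $R^{-1}(h)=\{g:(h,g)\in R\}$; $(c,a)\in Q\circ R$ iff $(c,b)\in Q$ and $(b,a)\in R$ for some $b$. $R$ is: edge-preserving if $(h,g),(h',g')\in R$ and $g\sqcap g'$ imply $h\sqcap h'$; co-bijective if $R(g)\ne\emptyset$ for all $g\in G$ and for all $h\in H$ there is $g$ with $R(g)=\{h\}$; edge-witnessing if $h\sqcap h'$ implies there is $g$ with $(h,g),(h',g)\in R$; anti-injective if $|R^{-1}(h)|\ge2$ for all $h$; star-refining if for all $g\in G$ there is $h\in H$ with $\{g':g'\sqcap g\}\subseteq R^{-1}(h)$. $\mathbf{B}$ is the category of graphs with co-bijective edge-preserving relations as morphisms. A sequence in $\mathbf{B}$ is a family $(G_n,R^m_n)_{m\le n\in\omega}$ with $R^m_n$ a morphism of $\mathbf{B}$ from $G_n$ to $G_m$, $R^n_n$ the identity and $R^l_m\circ R^m_n=R^l_n$ for $l\le m\le n$. It is edge-witnessing (anti-injective, star-refining) if $R^m_n$ is for all $m<n$. Its induced poset is the disjoint union $\mathbb{P}=\bigsqcup_nG_n$,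 where for $p\in G_n$, $q\in G_m$, $p\le q$ iff $m\le n$ and $(q,p)\in R^m_n$. In a poset $\mathbb{P}$, a band is a finite $B\subseteq\mathbb{P}$ such that every element of $\mathbb{P}$ is comparable to an element of $B$; a cap is a set $C\subseteq\mathbb P$ for which there is a band $B$ such that each $b\in B$ is $\le$ some $c\in C$; a selector is a subset of $\mathbb{P}$ meeting every cap. The spectrum $\mathsf{S}\mathbb{P}$ is the set of minimal selectors (with respect to inclusion) with the topology generated by the sets $p^\in=\{S\in\mathsf{S}\mathbb{P}:p\in S\}$, $p\in\mathbb{P}$. The spectrum of a sequence is the spectrum of its induced poset. *)

theory Defs
  imports "HOL-Analysis.Analysis"
begin

section \<open>Graphs and the category \<open>B\<close>\<close>

record 'v graph =
  verts :: "'v set"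
  edge :: "'v rel"

definition is_graph :: "'v graph \<Rightarrow> bool" where
  "is_graph G \<longleftrightarrow> finite (verts G) \<and> verts G \<noteq> {} \<and>
     edge G \<subseteq> verts G \<times> verts G \<and> refl_on (verts G) (edge G) \<and> sym (edge G)"

text \<open>A relation \<open>R \<subseteq> H \<times> G\<close> is regarded as going from \<open>G\<close> to \<open>H\<close>, so a pair
  \<open>(h, g) \<in> R\<close> has the target vertex first. With this orientation the composite of
  \<open>R\<close> followed by \<open>Q\<close> is \<open>Q O R\<close>. The predicates below take the source \<open>G\<close>
  before the target \<open>H\<close>.\<close>

definition rel_image :: "('w \<times> 'v) set \<Rightarrow> 'v \<Rightarrow> 'w set" where
  "rel_image R g = {h. (h, g) \<in> R}"

definition rel_preimage :: "('w \<times> 'v) set \<Rightarrow> 'w \<Rightarrow> 'v set" where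
  "rel_preimage R h = {g. (h, g) \<in> R}"

definition edge_preserving :: "'v graph \<Rightarrow> 'w graph \<Rightarrow> ('w \<times> 'v) set \<Rightarrow> bool" where
  "edge_preserving G H R \<longleftrightarrow>
     (\<forall>h g h' g'. (h, g) \<in> R \<and> (h', g') \<in> R \<and> (g, g') \<in> edge G \<longrightarrow> (h, h') \<in> edge H)"

definition co_bijective :: "'v graph \<Rightarrow> 'w graph \<Rightarrow> ('w \<times> 'v) set \<Rightarrow> bool" where
  "co_bijective G H R \<longleftrightarrow>
     (\<forall>g\<in>verts G. rel_image R g \<noteq> {}) \<and>
     (\<forall>h\<in>verts H. \<exists>g\<in>verts G. rel_image R g = {h})"

definition edge_witnessing :: "'v graph \<Rightarrow> 'w graph \<Rightarrow> ('w \<times> 'v) set \<Rightarrow> bool" where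
  "edge_witnessing G H R \<longleftrightarrow>
     (\<forall>h h'. (h, h') \<in> edge H \<longrightarrow> (\<exists>g\<in>verts G. (h, g) \<in> R \<and> (h', g) \<in> R))"

definition anti_injective :: "'v graph \<Rightarrow> 'w graph \<Rightarrow> ('w \<times> 'v) set \<Rightarrow> bool" where
  "anti_injective G H R \<longleftrightarrow> (\<forall>h\<in>verts H. 2 \<le> card (rel_preimage R h))"

definition star_refining :: "'v graph \<Rightarrow> 'w graph \<Rightarrow> ('w \<times> 'v) set \<Rightarrow> bool" where
  "star_refining G H R \<longleftrightarrow>
     (\<forall>g\<in>verts G. \<exists>h\<in>verts H. {g'. (g', g) \<in> edge G} \<subseteq> rel_preimage R h)"

definition B_morphism :: "'v graph \<Rightarrow> 'w graph \<Rightarrow> ('w \<times> 'v) set \<Rightarrow> bool" where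
  "B_morphism G H R \<longleftrightarrow> is_graph G \<and> is_graph H \<and> R \<subseteq> verts H \<times> verts G \<and>
     co_bijective G H R \<and> edge_preserving G H R"


section \<open>Sequences in \<open>B\<close>\<close>

text \<open>\<open>R m n\<close> is the bonding morphism from \<open>G n\<close> to \<open>G m\<close>. Only its values at
  \<open>m \<le> n\<close> are relevant.\<close>

definition B_sequence :: "(nat \<Rightarrow> 'v graph) \<Rightarrow> (nat \<Rightarrow> nat \<Rightarrow> 'v rel) \<Rightarrow> bool" where
  "B_sequence G R \<longleftrightarrow>
     (\<forall>m n. m \<le> n \<longrightarrow> B_morphism (G n) (G m) (R m n)) \<and>
     (\<forall>n. R n n = Id_on (verts (G n))) \<and>
     (\<forall>l m n. l \<le> m \<and> m \<le> n \<longrightarrow> R l m O R m n = R l n)"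

definition edge_witnessing_seq :: "(nat \<Rightarrow> 'v graph) \<Rightarrow> (nat \<Rightarrow> nat \<Rightarrow> 'v rel) \<Rightarrow> bool" where
  "edge_witnessing_seq G R \<longleftrightarrow> (\<forall>m n. m < n \<longrightarrow> edge_witnessing (G n) (G m) (R m n))"

definition anti_injective_seq :: "(nat \<Rightarrow> 'v graph) \<Rightarrow> (nat \<Rightarrow> nat \<Rightarrow> 'v rel) \<Rightarrow> bool" where
  "anti_injective_seq G R \<longleftrightarrow> (\<forall>m n. m < n \<longrightarrow> anti_injective (G n) (G m) (R m n))"

definition star_refining_seq :: "(nat \<Rightarrow> 'v graph) \<Rightarrow> (nat \<Rightarrow> nat \<Rightarrow> 'v rel) \<Rightarrow> bool" where
  "star_refining_seq G R \<longleftrightarrow> (\<forall>m n. m < n \<longrightarrow> star_refining (G n) (G m) (R m n))"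

text \<open>The disjoint union of the \<open>G n\<close> consists of the pairs \<open>(n, v)\<close> with \<open>v \<in> verts (G n)\<close>.
  A pair \<open>(p, q)\<close> in the order relation means \<open>p \<le> q\<close>.\<close>

definition induced_carrier :: "(nat \<Rightarrow> 'v graph) \<Rightarrow> (nat \<times> 'v) set" where
  "induced_carrier G = (SIGMA n:UNIV. verts (G n))"

definition induced_order :: "(nat \<Rightarrow> 'v graph) \<Rightarrow> (nat \<Rightarrow> nat \<Rightarrow> 'v rel) \<Rightarrow> (nat \<times> 'v) rel" where
  "induced_order G R = {((n, p), (m, q)) | n p m q.
     p \<in> verts (G n) \<and> q \<in> verts (G m) \<and> m \<le> n \<and> (q, p) \<in> R m n}"


section \<open>The spectrum of a poset\<close>

text \<open>Throughout, \<open>P\<close> is the carrier of the poset and \<open>r\<close> its order, with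
  \<open>(x, y) \<in> r\<close> meaning \<open>x \<le> y\<close>.\<close>

definition band :: "'p set \<Rightarrow> 'p rel \<Rightarrow> 'p set \<Rightarrow> bool" where
  "band P r B \<longleftrightarrow> finite B \<and> B \<subseteq> P \<and> (\<forall>p\<in>P. \<exists>b\<in>B. (p, b) \<in> r \<or> (b, p) \<in> r)"

definition cap :: "'p set \<Rightarrow> 'p rel \<Rightarrow> 'p set \<Rightarrow> bool" where
  "cap P r C \<longleftrightarrow> C \<subseteq> P \<and> (\<exists>B. band P r B \<and> (\<forall>b\<in>B. \<exists>c\<in>C. (b, c) \<in> r))"

definition selector :: "'p set \<Rightarrow> 'p rel \<Rightarrow> 'p set \<Rightarrow> bool" where
  "selector P r S \<longleftrightarrow> S \<subseteq> P \<and> (\<forall>C. cap P r C \<longrightarrow> S \<inter> C \<noteq> {})"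

definition minimal_selectors :: "'p set \<Rightarrow> 'p rel \<Rightarrow> 'p set set" where
  "minimal_selectors P r = {S. selector P r S \<and> (\<forall>T. selector P r T \<and> T \<subseteq> S \<longrightarrow> T = S)}"

definition spectrum_nhd :: "'p set \<Rightarrow> 'p rel \<Rightarrow> 'p \<Rightarrow> 'p set set" where
  "spectrum_nhd P r p = {S \<in> minimal_selectors P r. p \<in> S}"

text \<open>The constant \<open>topology_generated_by\<close> does not add the whole space as an open set. Inserting
  the set of all minimal selectors makes it the underlying set of the topology for every \<open>P\<close>
  and \<open>r\<close>.\<close>

definition spectrum :: "'p set \<Rightarrow> 'p rel \<Rightarrow> 'p set topology" where
  "spectrum P r =
     topology_generated_by (insert (minimal_selectors P r) (spectrum_nhd P r ` P))"

lemma topspace_spectrum: "topspace (spectrum P r) = minimal_selectors P r"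
  by (auto simp: spectrum_def topology_generated_by_topspace spectrum_nhd_def)

lemma induced_order_partial_order:
  assumes "B_sequence G R"
  shows "partial_order_on (induced_carrier G) (induced_order G R)"
proof -
  have refl_on: "refl_on (induced_carrier G) (induced_order G R)"
    using assms by (auto simp: refl_on_def induced_carrier_def induced_order_def B_sequence_def)
  have sub: "induced_order G R \<subseteq> induced_carrier G \<times> induced_carrier G"
    by (auto simp: induced_carrier_def induced_order_def)
  have antisym: "antisym (induced_order G R)"
    using assms by (auto simp: antisym_def induced_order_def B_sequence_def)
  have "(q, p) \<in> R l n" if "l \<le> m" "m \<le> n" "(q, x) \<in> R l m" "(x, p) \<in> R m n" for l m n q x p
    using assms that unfolding B_sequence_def by blast
  then have "trans (induced_order G R)"
    unfolding trans_def induced_order_def by (auto intro: order_trans)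
  then show ?thesis
    using refl_on sub antisym by (auto simp: partial_order_on_def preorder_on_def)
qed

definition sequence_spectrum ::
    "(nat \<Rightarrow> 'v graph) \<Rightarrow> (nat \<Rightarrow> nat \<Rightarrow> 'v rel) \<Rightarrow> (nat \<times> 'v) set topology" where
  "sequence_spectrum G R = spectrum (induced_carrier G) (induced_order G R)"


section \<open>Spaces without isolated points\<close>

definition perfect_topology :: "'a topology \<Rightarrow> bool" where
  "perfect_topology X \<longleftrightarrow> (\<forall>x\<in>topspace X. \<not> openin X {x})"

end

(*
  Given a finite family A of open sets, pick a finite set F of points meeting every class of points
  that lie in the same members of A, and for x in F let q_x be the intersection of all members of
  A containing x, with the other points of F removed. The sets q_x form a minimal open cover, each
  q_x has the private point x, and q_x is contained in a member of A as soon as that member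
  contains x. Iterate this with A containing all sets chosen before, one more member of a
  countable cofinal family of covers, and, if X is Hausdorff, a star refinement of the previous
  cover. The inclusion relations between the resulting covers then compose correctly, because an
  inclusion q <= p two or more levels apart can be interpolated: the base point of q lies in a set r of
  the intermediate level with r <= p, and hence q <= r. The point x of X corresponds to the
  selector of all sets containing x.
*)
theory Submission
  imports Defs
begin

section \<open>Barycentric and star refinements\<close>

text \<open>Regularity puts a closed \<open>K x\<close> between an open neighbourhood
  \<open>N x\<close> and some \<open>u x\<close> in \<open>U\<close>, and by compactness finitely
  many \<open>N x\<close> cover the space. It then suffices to find open sets such that each one
  meeting \<open>K x\<close> lies in \<open>u x\<close>.\<close>

lemma barycentric_refinement:
  assumes "compact_space X" "regular_space X"
    and openU: "\<And>u. u \<in> U \<Longrightarrow> openin X u" and coverU: "topspace X \<subseteq> \<Union>U"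
  obtains V where "finite V" "\<And>v. v \<in> V \<Longrightarrow> openin X v" "topspace X \<subseteq> \<Union>V"
    "\<And>y. y \<in> topspace X \<Longrightarrow> \<exists>u\<in>U. \<forall>v\<in>V. y \<in> v \<longrightarrow> v \<subseteq> u"
proof -
  have "\<exists>u N K. u \<in> U \<and> openin X N \<and> closedin X K \<and> x \<in> N \<and> N \<subseteq> K \<and> K \<subseteq> u"
    if x: "x \<in> topspace X" for x
  proof -
    obtain u where "u \<in> U" "x \<in> u"
      using x coverU by blast
    moreover have "neighbourhood_base_of (closedin X) X"
      using assms(2) by (simp add: neighbourhood_base_of_closedin)
    ultimately show ?thesis
      using openU unfolding neighbourhood_base_of by meson
  qed
  then obtain u N K where uNK: "\<And>x. x \<in> topspace X \<Longrightarrow>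
      u x \<in> U \<and> openin X (N x) \<and> closedin X (K x) \<and> x \<in> N x \<and> N x \<subseteq> K x \<and> K x \<subseteq> u x"
    by metis
  have "\<forall>V\<in>N ` topspace X. openin X V" "topspace X \<subseteq> \<Union>(N ` topspace X)"
    using uNK by auto
  then obtain \<F> where \<F>: "finite \<F>" "\<F> \<subseteq> N ` topspace X" "topspace X \<subseteq> \<Union>\<F>"
    using assms(1) unfolding compact_space_alt by meson
  then obtain F where F: "finite F" "F \<subseteq> topspace X" "\<F> = N ` F"
    by (meson finite_subset_image)
  \<comment> \<open>\<open>T\<close> prescribes which \<open>u x\<close> contain the set; the
    remaining \<open>K x\<close> are cut away. A point \<open>y\<close> lies in \<open>W T\<close>
    for \<open>T\<close> the set of \<open>x\<close> in \<open>F\<close> with \<open>y\<close> in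
    \<open>K x\<close>, and a set \<open>W T\<close> that meets \<open>K x\<close> must have
    \<open>x\<close> in \<open>T\<close>.\<close>
  define W where "W T = (topspace X \<inter> \<Inter>(u ` T)) - \<Union>(K ` (F - T))" for T
  define V where "V = W ` (Pow F)"
  show ?thesis
  proof
    show "finite V"
      using F by (simp add: V_def)
    show "openin X v" if "v \<in> V" for v
    proof -
      obtain T where T: "T \<subseteq> F" "v = W T"
        using \<open>v \<in> V\<close> V_def by auto
      have "finite T"
        using T F finite_subset by blast
      then have "openin X (topspace X \<inter> \<Inter>(u ` T))"
        using T F uNK openU by (intro openin_Int_Inter) auto
      moreover have "closedin X (\<Union>(K ` (F - T)))"
        using F uNK by (intro closedin_Union) auto
      ultimately show ?thesis
        by (simp add: T W_def openin_diff)
    qed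
    show "topspace X \<subseteq> \<Union>V"
    proof
      fix y assume y: "y \<in> topspace X"
      then have "y \<in> W {x \<in> F. y \<in> K x}"
        using uNK F by (auto simp: W_def)
      then show "y \<in> \<Union>V"
        by (auto simp: V_def)
    qed
    fix y assume "y \<in> topspace X"
    then obtain x where x: "x \<in> F" "y \<in> K x"
      using F \<F> uNK by blast
    then have "v \<subseteq> u x" if "v \<in> V" "y \<in> v" for v
      using that by (auto simp: V_def W_def)
    then show "\<exists>u\<in>U. \<forall>v\<in>V. y \<in> v \<longrightarrow> v \<subseteq> u"
      using x F uNK by blast
  qed
qed

text \<open>Barycentric refinement is applied twice. If \<open>d'\<close> meets \<open>d\<close> in
  \<open>z\<close>, a single \<open>v\<close> in \<open>V\<close> contains both. For a fixed
  \<open>y\<close> in \<open>d\<close>, every such \<open>v\<close> contains \<open>y\<close>, hence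
  lies in the one \<open>u\<close> chosen for \<open>y\<close>.\<close>

lemma star_refinement:
  assumes X: "compact_space X" "regular_space X" and "topspace X \<noteq> {}"
    and openU: "\<And>u. u \<in> U \<Longrightarrow> openin X u" and coverU: "topspace X \<subseteq> \<Union>U"
  obtains D where "finite D" "\<And>d. d \<in> D \<Longrightarrow> openin X d" "topspace X \<subseteq> \<Union>D"
    "\<And>d. d \<in> D \<Longrightarrow> \<exists>u\<in>U. \<forall>d'\<in>D. d \<inter> d' \<noteq> {} \<longrightarrow> d' \<subseteq> u"
proof -
  obtain V where V: "finite V" "\<And>v. v \<in> V \<Longrightarrow> openin X v" "topspace X \<subseteq> \<Union>V"
    "\<And>y. y \<in> topspace X \<Longrightarrow> \<exists>u\<in>U. \<forall>v\<in>V. y \<in> v \<longrightarrow> v \<subseteq> u"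
    using barycentric_refinement[OF X openU coverU] by metis
  obtain D where D: "finite D" "\<And>d. d \<in> D \<Longrightarrow> openin X d" "topspace X \<subseteq> \<Union>D"
    "\<And>y. y \<in> topspace X \<Longrightarrow> \<exists>v\<in>V. \<forall>d\<in>D. y \<in> d \<longrightarrow> d \<subseteq> v"
    using barycentric_refinement[OF X V(2,3)] by metis
  show ?thesis
  proof
    fix d assume d: "d \<in> D"
    show "\<exists>u\<in>U. \<forall>d'\<in>D. d \<inter> d' \<noteq> {} \<longrightarrow> d' \<subseteq> u"
    \<comment> \<open>\<open>D\<close> may contain the empty set, which offers no point
      \<open>y\<close>. Any \<open>u\<close> works then, and one exists because the space is
      non-empty.\<close>
    proof (cases "d = {}")
      case True
      then show ?thesis
        using coverU \<open>topspace X \<noteq> {}\<close> by blast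
    next
      case False
      then obtain y where y: "y \<in> d" "y \<in> topspace X"
        using D(2)[OF d] openin_subset by blast
      then obtain u where u: "u \<in> U" "\<forall>v\<in>V. y \<in> v \<longrightarrow> v \<subseteq> u"
        using V(4) by blast
      have "d' \<subseteq> u" if d': "d' \<in> D" "d \<inter> d' \<noteq> {}" for d'
      proof -
        obtain z where z: "z \<in> d" "z \<in> d'" "z \<in> topspace X"
          using d' D(2)[OF d] openin_subset by blast
        then obtain v where "v \<in> V" "\<forall>d\<in>D. z \<in> d \<longrightarrow> d \<subseteq> v"
          using D(4) by blast
        then show ?thesis
          using z d d' u y by blast
      qed
      then show ?thesis
        using u by blast
    qed
  qed (use D in auto)
qed


section \<open>Fine families of open sets\<close>

text \<open>The fourth clause gives every member of \<open>C\<close> a private point that moreover decides which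
  members of \<open>A\<close> contain it. This is what makes the inclusion order between
  successive fine families interpolate.\<close>

definition fine_family :: "'a topology \<Rightarrow> 'a set set \<Rightarrow> 'a set set \<Rightarrow> bool" where
  "fine_family X A C \<longleftrightarrow> finite C \<and> (\<forall>q\<in>C. openin X q) \<and>
     (\<forall>y\<in>topspace X. \<exists>q\<in>C. y \<in> q \<and> (\<forall>a\<in>A. y \<in> a \<longrightarrow> q \<subseteq> a)) \<and>
     (\<forall>q\<in>C. \<exists>x\<in>q. (\<forall>q'\<in>C. x \<in> q' \<longrightarrow> q' = q) \<and> (\<forall>a\<in>A. x \<in> a \<longrightarrow> q \<subseteq> a)) \<and>
     (\<forall>a\<in>A. (\<exists>x\<in>a. \<exists>y\<in>a. x \<noteq> y) \<longrightarrow> (\<exists>q\<in>C. \<exists>q'\<in>C. q \<noteq> q' \<and> q \<subseteq> a \<and> q' \<subseteq> a))"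

lemma fine_family_exists:
  assumes "t1_space X" "finite A" and openA: "\<And>a. a \<in> A \<Longrightarrow> openin X a"
  shows "\<exists>C. fine_family X A C"
proof -
  define above where "above y = {a \<in> A. y \<in> a}" for y
  define A2 where "A2 = {a \<in> A. \<exists>x\<in>a. \<exists>y\<in>a. x \<noteq> y}"
  have sub: "a \<subseteq> topspace X" if "a \<in> A" for a
    using openA that openin_subset by blast
  have "above ` topspace X \<subseteq> Pow A"
    by (auto simp: above_def)
  then have "finite (above ` topspace X)"
    using \<open>finite A\<close> finite_subset by blast
  \<comment> \<open>\<open>F0\<close> meets every class of points lying in the same members of
    \<open>A\<close>.\<close>
  then obtain F0 where F0: "F0 \<subseteq> topspace X" "finite F0" "above ` topspace X = above ` F0"
    by (meson finite_subset_image subset_refl)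
  \<comment> \<open>Two points of each \<open>a\<close> with more than one point are put into
    \<open>F\<close>, so that \<open>q (g a)\<close> and \<open>q (h a)\<close> become two distinct
    members inside \<open>a\<close>.\<close>
  have "\<forall>a\<in>A2. \<exists>x y. x \<in> a \<and> y \<in> a \<and> x \<noteq> y"
    by (auto simp: A2_def)
  then obtain g h where gh: "\<And>a. a \<in> A2 \<Longrightarrow> g a \<in> a \<and> h a \<in> a \<and> g a \<noteq> h a"
    by metis
  define F where "F = F0 \<union> g ` A2 \<union> h ` A2"
  have A2: "A2 \<subseteq> A" "finite A2"
    using \<open>finite A\<close> by (auto simp: A2_def)
  have F: "finite F" "F \<subseteq> topspace X"
  proof -
    have "g a \<in> topspace X \<and> h a \<in> topspace X" if "a \<in> A2" for a
      using gh[OF that] sub[of a] that A2 by blast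
    then have "g ` A2 \<subseteq> topspace X" "h ` A2 \<subseteq> topspace X"
      by blast+
    then show "finite F" "F \<subseteq> topspace X"
      using F0 A2 by (simp_all add: F_def)
  qed
  define q where "q x = (topspace X \<inter> \<Inter>(above x)) - (F - {x})" for x
  have q_self: "x \<in> q x" if "x \<in> F" for x
    using that F by (auto simp: q_def above_def)
  have q_sub: "q x \<subseteq> a" if "a \<in> A" "x \<in> a" for x a
    using that by (auto simp: q_def above_def)
  have q_private: "x' = x" if "x \<in> q x'" "x \<in> F" for x x'
    using that by (auto simp: q_def)
  have fin_above: "finite (above x)" for x
    using \<open>finite A\<close> by (simp add: above_def)
  have q_open: "openin X (q x)" for x
  proof -
    have "openin X (topspace X \<inter> \<Inter>(above x))"
      using fin_above openA by (intro openin_Int_Inter) (auto simp: above_def)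
    \<comment> \<open>This is where T1 enters: finite sets are closed, so deleting points keeps
      \<open>q x\<close> open.\<close>
    moreover have "closedin X (F - {x})"
      using F \<open>t1_space X\<close> t1_space_closedin_finite by (metis Diff_subset finite_Diff subset_trans)
    ultimately show ?thesis
      by (simp add: q_def openin_diff)
  qed
  have "fine_family X A (q ` F)"
    unfolding fine_family_def
  proof (intro conjI ballI impI)
    fix y assume y: "y \<in> topspace X"
    show "\<exists>p\<in>q ` F. y \<in> p \<and> (\<forall>a\<in>A. y \<in> a \<longrightarrow> p \<subseteq> a)"
    proof (cases "y \<in> F")
      case True
      then show ?thesis
        using q_self q_sub by blast
    next
      case False
      \<comment> \<open>A representative of the class of \<open>y\<close>. As \<open>y\<close> is
        not in \<open>F\<close>, deleting \<open>F - {x}\<close> does not remove it.\<close>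
      obtain x where x: "x \<in> F" "above x = above y"
      proof -
        have "above y \<in> above ` F0"
          using F0(3) y by blast
        then show ?thesis
          using that by (auto simp: F_def)
      qed
      then have "y \<in> q x"
        using False y by (auto simp: q_def above_def)
      moreover have "q x \<subseteq> a" if "a \<in> A" "y \<in> a" for a
        using that q_sub x by (auto simp: above_def set_eq_iff)
      ultimately show ?thesis
        using x by blast
    qed
  next
    fix p assume "p \<in> q ` F"
    then show "\<exists>x\<in>p. (\<forall>q'\<in>q ` F. x \<in> q' \<longrightarrow> q' = p) \<and> (\<forall>a\<in>A. x \<in> a \<longrightarrow> p \<subseteq> a)"
      using q_self q_sub q_private by blast
  next
    fix a assume "a \<in> A" "\<exists>x\<in>a. \<exists>y\<in>a. x \<noteq> y"
    then have a: "a \<in> A2"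
      by (simp add: A2_def)
    then have "g a \<in> F" "h a \<in> F"
      by (auto simp: F_def)
    moreover have "q (g a) \<noteq> q (h a)"
      using calculation gh[OF a] q_self q_private by metis
    ultimately show "\<exists>p\<in>q ` F. \<exists>p'\<in>q ` F. p \<noteq> p' \<and> p \<subseteq> a \<and> p' \<subseteq> a"
      using gh[OF a] q_sub[OF \<open>a \<in> A\<close>] by blast
  qed (use F q_open in auto)
  then show ?thesis ..
qed


section \<open>The sequence of a family of fine covers\<close>

text \<open>\<open>A n\<close> collects the open sets that level \<open>n\<close> must respect; by
  \<open>step\<close> it contains all earlier covers. \<open>resolve\<close> is the form in which
  second countability enters: it forces the sets through \<open>x\<close> at high levels into
  \<open>U\<close>.\<close>

locale fine_covers =
  fixes X :: "'a topology" and A C :: "nat \<Rightarrow> 'a set set"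
  assumes nonempty: "topspace X \<noteq> {}"
    and compact: "compact_space X"
    and t1: "t1_space X"
    and fine: "fine_family X (A n) (C n)"
    and step: "A n \<union> C n \<subseteq> A (Suc n)"
    and resolve: "openin X U \<Longrightarrow> x \<in> U \<Longrightarrow>
      \<exists>n. \<exists>E\<subseteq>A n. topspace X \<subseteq> \<Union>E \<and> (\<forall>e\<in>E. x \<in> e \<longrightarrow> e \<subseteq> U)"
begin

section \<open>Inclusions between the levels\<close>

lemma finite_C: "finite (C n)"
  and open_C: "q \<in> C n \<Longrightarrow> openin X q"
  using fine[of n] by (simp_all add: fine_family_def)

lemma fine_nbhd:
  assumes "y \<in> topspace X" shows "\<exists>q\<in>C n. y \<in> q \<and> (\<forall>a\<in>A n. y \<in> a \<longrightarrow> q \<subseteq> a)"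
  using fine[of n] assms unfolding fine_family_def by (elim conjE) (rule bspec)

lemma base_point:
  assumes "q \<in> C n"
  shows "\<exists>x\<in>q. (\<forall>q'\<in>C n. x \<in> q' \<longrightarrow> q' = q) \<and> (\<forall>a\<in>A n. x \<in> a \<longrightarrow> q \<subseteq> a)"
  using fine[of n] assms unfolding fine_family_def by (elim conjE) (rule bspec)

lemma two_below:
  assumes "a \<in> A n" "x \<in> a" "y \<in> a" "x \<noteq> y"
  shows "\<exists>q\<in>C n. \<exists>q'\<in>C n. q \<noteq> q' \<and> q \<subseteq> a \<and> q' \<subseteq> a"
proof -
  have "\<forall>a\<in>A n. (\<exists>x\<in>a. \<exists>y\<in>a. x \<noteq> y) \<longrightarrow> (\<exists>q\<in>C n. \<exists>q'\<in>C n. q \<noteq> q' \<and> q \<subseteq> a \<and> q' \<subseteq> a)"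
    using fine[of n] by (simp add: fine_family_def)
  then show ?thesis
    using assms by metis
qed

lemma A_mono: assumes "m \<le> n" shows "A m \<subseteq> A n"
proof (rule lift_Suc_mono_le[of A, OF _ assms])
  show "A k \<subseteq> A (Suc k)" for k
    using step[of k] by simp
qed

lemma C_sub_A: "m < n \<Longrightarrow> C m \<subseteq> A n"
  using step[of m] A_mono[of "Suc m" n] by auto

lemma C_sub_topspace: "q \<in> C n \<Longrightarrow> q \<subseteq> topspace X"
  by (simp add: open_C openin_subset)

text \<open>The private point of \<open>p\<close> lies in \<open>q\<close>. This makes
  \<open>R n n\<close> the identity.\<close>

lemma C_antichain: "p \<in> C n \<Longrightarrow> q \<in> C n \<Longrightarrow> p \<subseteq> q \<longleftrightarrow> p = q"
  using base_point by blast

text \<open>The base point of \<open>q\<close> lies in some \<open>p\<close> of \<open>C m\<close>,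
  and \<open>p\<close> belongs to \<open>A n\<close> when \<open>m < n\<close>, so all of
  \<open>q\<close> follows.\<close>

lemma refines: assumes "q \<in> C n" "m \<le> n" shows "\<exists>p\<in>C m. q \<subseteq> p"
proof (cases "m = n")
  case False
  obtain x where x: "x \<in> q" "\<forall>a\<in>A n. x \<in> a \<longrightarrow> q \<subseteq> a"
    using base_point assms by blast
  moreover obtain p where "p \<in> C m" "x \<in> p"
    using fine_nbhd[of x m] x(1) C_sub_topspace[OF assms(1)] by blast
  ultimately show ?thesis
    using C_sub_A[of m n] False assms by auto
qed (use assms in auto)

lemma nbhd_below: assumes "p \<in> C m" "y \<in> p" "m < n"
  shows "\<exists>q\<in>C n. y \<in> q \<and> (\<forall>p'\<in>C m. y \<in> p' \<longrightarrow> q \<subseteq> p')"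
proof -
  have "y \<in> topspace X"
    using assms C_sub_topspace by blast
  then obtain q where "q \<in> C n" "y \<in> q" "\<forall>a\<in>A n. y \<in> a \<longrightarrow> q \<subseteq> a"
    using fine_nbhd[of y n] by blast
  then show ?thesis
    using C_sub_A[OF \<open>m < n\<close>] by blast
qed

text \<open>A member of \<open>C n\<close> through the private point of \<open>p\<close> cannot lie
  in any other member of \<open>C m\<close>.\<close>

lemma co_bijective_C: assumes "p \<in> C m" "m \<le> n"
  shows "\<exists>q\<in>C n. q \<subseteq> p \<and> (\<forall>p'\<in>C m. q \<subseteq> p' \<longrightarrow> p' = p)"
proof (cases "m = n")
  case False
  obtain x where x: "x \<in> p" "\<forall>p'\<in>C m. x \<in> p' \<longrightarrow> p' = p"
    using base_point[OF assms(1)] by blast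
  have "m < n"
    using assms False by simp
  then obtain q where "q \<in> C n" "x \<in> q" "q \<subseteq> p"
    using nbhd_below[OF assms(1) x(1)] assms(1) x(1) by meson
  then show ?thesis
    using x(2) by blast
qed (use assms C_antichain in auto)

lemma interpolation:
  assumes "p \<in> C l" "q \<in> C n" "q \<subseteq> p" "l \<le> m" "m \<le> n"
  shows "\<exists>r\<in>C m. q \<subseteq> r \<and> r \<subseteq> p"
proof (cases "l = m \<or> m = n")
  case False
  then have "l < m" "m < n"
    using assms by auto
  obtain x where x: "x \<in> q" "\<forall>a\<in>A n. x \<in> a \<longrightarrow> q \<subseteq> a"
    using base_point assms by blast
  obtain r where "r \<in> C m" "x \<in> r" "r \<subseteq> p"
    using nbhd_below[OF assms(1) _ \<open>l < m\<close>, of x] x(1) assms(1,3) by blast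
  then show ?thesis
    using x C_sub_A[OF \<open>m < n\<close>] by blast
qed (use assms in auto)

text \<open>From level \<open>k\<close> on, the cover \<open>E\<close> is part of
  \<open>A n\<close>, so the base point of \<open>q\<close> puts \<open>q\<close> inside some
  \<open>e\<close> in \<open>E\<close>. If \<open>x\<close> is in \<open>q\<close>, it is in
  \<open>e\<close>, whence \<open>e\<close> lies in \<open>U\<close>. Thus the members through
  \<open>x\<close> form a neighbourhood base.\<close>

lemma eventually_sub: assumes "openin X U" "x \<in> U"
  obtains k where "\<And>n q. k \<le> n \<Longrightarrow> q \<in> C n \<Longrightarrow> x \<in> q \<Longrightarrow> q \<subseteq> U"
proof -
  obtain k E where E: "E \<subseteq> A k" "topspace X \<subseteq> \<Union>E" "\<forall>e\<in>E. x \<in> e \<longrightarrow> e \<subseteq> U"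
    using resolve[OF assms] by (elim exE conjE) (rule that)
  have "q \<subseteq> U" if "k \<le> n" and q: "q \<in> C n" "x \<in> q" for n q
  proof -
    obtain y where y: "y \<in> q" "\<forall>a\<in>A n. y \<in> a \<longrightarrow> q \<subseteq> a"
      using base_point q by blast
    have "y \<in> topspace X"
      using y q C_sub_topspace by blast
    then obtain e where e: "e \<in> E" "y \<in> e"
      using E(2) by blast
    then have "q \<subseteq> e"
      using y E(1) A_mono[OF \<open>k \<le> n\<close>] by blast
    then show ?thesis
      using E(3) e q by blast
  qed
  then show ?thesis
    using that by blast
qed

text \<open>Vertices are to be natural numbers. One injection serves all levels; a set occurring at
  several levels keeps its code, and only the level component of the poset tells the copies
  apart.\<close>

definition enc :: "'a set \<Rightarrow> nat" where
  "enc = to_nat_on (\<Union>n. C n)"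

lemma enc_eq_iff [simp]: "p \<in> C m \<Longrightarrow> q \<in> C n \<Longrightarrow> enc p = enc q \<longleftrightarrow> p = q"
proof -
  have "countable (\<Union>n. C n)"
    by (simp add: finite_C countable_finite)
  then show "p \<in> C m \<Longrightarrow> q \<in> C n \<Longrightarrow> enc p = enc q \<longleftrightarrow> p = q"
    unfolding enc_def by (meson UN_I UNIV_I inj_on_eq_iff inj_on_to_nat_on)
qed

definition G :: "nat \<Rightarrow> nat graph" where
  "G n = \<lparr>verts = enc ` C n, edge = {(enc p, enc q) | p q. p \<in> C n \<and> q \<in> C n \<and> p \<inter> q \<noteq> {}}\<rparr>"

definition R :: "nat \<Rightarrow> nat \<Rightarrow> nat rel" where
  "R m n = {(enc p, enc q) | p q. p \<in> C m \<and> q \<in> C n \<and> q \<subseteq> p}"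

lemma verts_G [simp]: "verts (G n) = enc ` C n"
  by (simp add: G_def)

lemma edge_G [simp]:
  "p \<in> C n \<Longrightarrow> q \<in> C n \<Longrightarrow> (enc p, enc q) \<in> edge (G n) \<longleftrightarrow> p \<inter> q \<noteq> {}"
  by (auto simp: G_def)

lemma edge_G_E:
  assumes "(u, v) \<in> edge (G n)"
  obtains p q where "u = enc p" "v = enc q" "p \<in> C n" "q \<in> C n" "p \<inter> q \<noteq> {}"
  using assms by (auto simp: G_def)

lemma R_iff [simp]: "p \<in> C m \<Longrightarrow> q \<in> C n \<Longrightarrow> (enc p, enc q) \<in> R m n \<longleftrightarrow> q \<subseteq> p"
  by (auto simp: R_def)

lemma R_E:
  assumes "(u, v) \<in> R m n"
  obtains p q where "u = enc p" "v = enc q" "p \<in> C m" "q \<in> C n" "q \<subseteq> p"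
  using assms by (auto simp: R_def)

lemma C_nonempty: "C n \<noteq> {}" "p \<in> C n \<Longrightarrow> p \<noteq> {}"
  using fine_nbhd nonempty base_point by blast+

section \<open>Properties of the sequence\<close>

lemma is_graph_G: "is_graph (G n)"
proof -
  have "refl_on (verts (G n)) (edge (G n))"
    using C_nonempty by (auto simp: refl_on_def elim: edge_G_E)
  moreover have "sym (edge (G n))"
    by (auto simp: sym_def elim!: edge_G_E)
  moreover have "edge (G n) \<subseteq> verts (G n) \<times> verts (G n)"
    by (auto elim: edge_G_E)
  ultimately show ?thesis
    using finite_C C_nonempty by (auto simp: is_graph_def)
qed

lemma B_morphism_R: assumes "m \<le> n" shows "B_morphism (G n) (G m) (R m n)"
proof -
  have "rel_image (R m n) (enc q) \<noteq> {}" if q: "q \<in> C n" for q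
  proof -
    obtain p where "p \<in> C m" "q \<subseteq> p"
      using refines[OF q assms] by blast
    then have "enc p \<in> rel_image (R m n) (enc q)"
      using q by (simp add: rel_image_def)
    then show ?thesis
      by blast
  qed
  moreover have "\<exists>g\<in>verts (G n). rel_image (R m n) g = {enc p}" if p: "p \<in> C m" for p
  proof -
    obtain q where q: "q \<in> C n" "q \<subseteq> p" "\<forall>p'\<in>C m. q \<subseteq> p' \<longrightarrow> p' = p"
      using co_bijective_C[OF p assms] by blast
    have "u = enc p" if u: "(u, enc q) \<in> R m n" for u
    proof -
      obtain p' q' where p': "u = enc p'" "enc q = enc q'" "p' \<in> C m" "q' \<in> C n" "q' \<subseteq> p'"
        using u by (rule R_E)
      then have "q \<subseteq> p'"
        using q(1) by simp
      then show ?thesis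
        using q(3) p'(1,3) by blast
    qed
    moreover have "(enc p, enc q) \<in> R m n"
      using p q(1,2) by simp
    ultimately have "rel_image (R m n) (enc q) = {enc p}"
      unfolding rel_image_def by blast
    then show ?thesis
      using q(1) by auto
  qed
  ultimately have "co_bijective (G n) (G m) (R m n)"
    by (auto simp: co_bijective_def)
  moreover have "edge_preserving (G n) (G m) (R m n)"
    unfolding edge_preserving_def
  proof (intro allI impI, elim conjE)
    fix h g h' g'
    assume "(h, g) \<in> R m n" "(h', g') \<in> R m n" and e: "(g, g') \<in> edge (G n)"
    then obtain p q p' q' where
      "h = enc p" "g = enc q" "p \<in> C m" "q \<in> C n" "q \<subseteq> p"
      "h' = enc p'" "g' = enc q'" "p' \<in> C m" "q' \<in> C n" "q' \<subseteq> p'"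
      by (meson R_E)
    then show "(h, h') \<in> edge (G m)"
      using e by auto
  qed
  moreover have "R m n \<subseteq> verts (G m) \<times> verts (G n)"
    by (auto elim: R_E)
  ultimately show ?thesis
    using is_graph_G by (simp add: B_morphism_def)
qed

lemma B_sequence: "B_sequence G R"
proof -
  have "R n n = Id_on (verts (G n))" for n
    using C_antichain by (auto simp: R_def Id_on_def)
  moreover have "R l m O R m n = R l n" if le: "l \<le> m" "m \<le> n" for l m n
  proof
    show "R l m O R m n \<subseteq> R l n"
    proof clarify
      fix u v w assume "(u, v) \<in> R l m" "(v, w) \<in> R m n"
      moreover obtain p r where "u = enc p" "v = enc r" "p \<in> C l" "r \<in> C m" "r \<subseteq> p"
        using \<open>(u, v) \<in> R l m\<close> by (rule R_E)
      moreover obtain r' q where "v = enc r'" "w = enc q" "r' \<in> C m" "q \<in> C n" "q \<subseteq> r'"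
        using \<open>(v, w) \<in> R m n\<close> by (rule R_E)
      ultimately show "(u, w) \<in> R l n"
        by auto
    qed
    show "R l n \<subseteq> R l m O R m n"
    proof clarify
      fix u v assume "(u, v) \<in> R l n"
      then obtain p q where pq: "u = enc p" "v = enc q" "p \<in> C l" "q \<in> C n" "q \<subseteq> p"
        by (rule R_E)
      then obtain r where "r \<in> C m" "q \<subseteq> r" "r \<subseteq> p"
        using interpolation[OF pq(3,4,5) le] by blast
      then show "(u, v) \<in> R l m O R m n"
        using pq by (intro relcompI[of _ "enc r"]) auto
    qed
  qed
  ultimately show ?thesis
    using B_morphism_R by (auto simp: B_sequence_def)
qed

text \<open>An edge is a pair of sets with a common point; a small enough member of
  \<open>C n\<close> around that point lies in both.\<close>

lemma edge_witnessing_seq: "edge_witnessing_seq G R"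
  unfolding edge_witnessing_seq_def edge_witnessing_def
proof (intro allI impI)
  fix m n :: nat and h h' assume "m < n" "(h, h') \<in> edge (G m)"
  then obtain p p' where p: "h = enc p" "h' = enc p'" "p \<in> C m" "p' \<in> C m" "p \<inter> p' \<noteq> {}"
    by (meson edge_G_E)
  then obtain y where "y \<in> p" "y \<in> p'" by blast
  then obtain q where "q \<in> C n" "q \<subseteq> p" "q \<subseteq> p'"
    using nbhd_below[OF p(3) _ \<open>m < n\<close>, of y] p(3,4) by blast
  then show "\<exists>g\<in>verts (G n). (h, g) \<in> R m n \<and> (h', g) \<in> R m n"
    using p by auto
qed

lemma anti_injective_seq: assumes "perfect_topology X" shows "anti_injective_seq G R"
  unfolding anti_injective_seq_def anti_injective_def
proof (intro allI impI ballI)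
  fix m n :: nat and h assume "m < n" "h \<in> verts (G m)"
  then obtain p where p: "p \<in> C m" "h = enc p" by auto
  obtain x where x: "x \<in> p"
    using p C_nonempty by blast
  \<comment> \<open>\<open>p\<close> is open, so being a singleton would make \<open>x\<close>
    isolated.\<close>
  have "p \<noteq> {x}"
    using assms x open_C[OF p(1)] C_sub_topspace[OF p(1)] unfolding perfect_topology_def by blast
  then obtain y where "y \<in> p" "x \<noteq> y"
    using x by blast
  moreover have "p \<in> A n"
    using p(1) C_sub_A[OF \<open>m < n\<close>] by blast
  ultimately obtain q q' where q: "q \<in> C n" "q' \<in> C n" "q \<noteq> q'" "q \<subseteq> p" "q' \<subseteq> p"
    using two_below x by meson
  \<comment> \<open>Finiteness matters because \<open>card\<close> is 0 on infinite sets.\<close>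
  have "rel_preimage (R m n) h \<subseteq> enc ` C n"
    by (auto simp: rel_preimage_def elim: R_E)
  then have "finite (rel_preimage (R m n) h)"
    using finite_C finite_subset by blast
  moreover have "{enc q, enc q'} \<subseteq> rel_preimage (R m n) h"
    using q p by (auto simp: rel_preimage_def)
  ultimately have "card {enc q, enc q'} \<le> card (rel_preimage (R m n) h)"
    by (rule card_mono)
  moreover have "card {enc q, enc q'} = 2"
    using q by simp
  ultimately show "2 \<le> card (rel_preimage (R m n) h)"
    by simp
qed

text \<open>Every member of \<open>C n\<close> lies in a member of \<open>D\<close>. If
  \<open>q\<close> lies in \<open>d\<close>, the neighbours of \<open>q\<close> lie in members of
  \<open>D\<close> that meet \<open>d\<close>, hence in the common \<open>u\<close>.\<close>

lemma star_refining_seq: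
  assumes star: "\<And>n. \<exists>D\<subseteq>A (Suc n). topspace X \<subseteq> \<Union>D \<and>
    (\<forall>d\<in>D. \<exists>u\<in>C n. \<forall>d'\<in>D. d \<inter> d' \<noteq> {} \<longrightarrow> d' \<subseteq> u)"
  shows "star_refining_seq G R"
  unfolding star_refining_seq_def star_refining_def
proof (intro allI impI ballI)
  fix m n :: nat and g assume "m < n" "g \<in> verts (G n)"
  then obtain q where q: "q \<in> C n" "g = enc q" by auto
  obtain D where D: "D \<subseteq> A (Suc m)" "topspace X \<subseteq> \<Union>D"
    "\<forall>d\<in>D. \<exists>u\<in>C m. \<forall>d'\<in>D. d \<inter> d' \<noteq> {} \<longrightarrow> d' \<subseteq> u"
    using star[of m] by (elim exE conjE) (rule that)
  have DA: "D \<subseteq> A n"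
    using D A_mono[of "Suc m" n] \<open>m < n\<close> by auto
  have refD: "\<exists>d\<in>D. q' \<subseteq> d" if q': "q' \<in> C n" for q'
  proof -
    obtain x where x: "x \<in> q'" "\<forall>a\<in>A n. x \<in> a \<longrightarrow> q' \<subseteq> a"
      using base_point[OF q'] by blast
    moreover obtain d where "d \<in> D" "x \<in> d"
      using x(1) C_sub_topspace[OF q'] D(2) by blast
    ultimately show ?thesis
      using DA by blast
  qed
  from refD[OF q(1)] obtain d where d: "d \<in> D" "q \<subseteq> d"
    by blast
  obtain u where u: "u \<in> C m" "\<forall>d'\<in>D. d \<inter> d' \<noteq> {} \<longrightarrow> d' \<subseteq> u"
    using bspec[OF D(3) d(1)] by (elim bexE) (rule that)
  have "q' \<subseteq> u" if "q' \<in> C n" "q' \<inter> q \<noteq> {}" for q'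
    using refD[OF that(1)] that(2) d u by blast
  then have "g' \<in> rel_preimage (R m n) (enc u)" if "(g', g) \<in> edge (G n)" for g'
    using that q u(1) by (elim edge_G_E) (simp add: rel_preimage_def)
  then show "\<exists>h\<in>verts (G m). {g'. (g', g) \<in> edge (G n)} \<subseteq> rel_preimage (R m n) h"
    using u by auto
qed


section \<open>The spectrum of the sequence\<close>

abbreviation (input) P where "P \<equiv> induced_carrier G"
abbreviation (input) r where "r \<equiv> induced_order G R"

lemma P_iff: "(n, v) \<in> P \<longleftrightarrow> (\<exists>p\<in>C n. v = enc p)"
  by (auto simp: induced_carrier_def)

lemma r_iff:
  "p \<in> C n \<Longrightarrow> q \<in> C m \<Longrightarrow> ((n, enc p), (m, enc q)) \<in> r \<longleftrightarrow> m \<le> n \<and> p \<subseteq> q"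
  by (auto simp: induced_order_def)

lemma r_E:
  assumes "(a, b) \<in> r"
  obtains n p m q where "a = (n, enc p)" "b = (m, enc q)" "p \<in> C n" "q \<in> C m" "m \<le> n" "p \<subseteq> q"
proof -
  obtain n u m v where *: "a = (n, u)" "b = (m, v)" "u \<in> verts (G n)" "v \<in> verts (G m)"
    "m \<le> n" "(v, u) \<in> R m n"
    using assms by (auto simp: induced_order_def)
  moreover obtain p q where "v = enc q" "u = enc p" "q \<in> C m" "p \<in> C n" "p \<subseteq> q"
    using *(6) by (rule R_E)
  ultimately show ?thesis
    using that by blast
qed

text \<open>Vertices of earlier levels have something below them at level \<open>n\<close> by
  \<open>co_bijective_C\<close>; those of later levels lie below something there by
  \<open>refines\<close>.\<close>

lemma band_level: "band P r ({n} \<times> verts (G n))"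
proof -
  have "\<exists>b\<in>{n} \<times> verts (G n). (x, b) \<in> r \<or> (b, x) \<in> r" if xP: "x \<in> P" for x
  proof -
    obtain m p where x: "x = (m, enc p)" "p \<in> C m"
      using xP by (cases x) (auto simp: P_iff)
    show ?thesis
    proof (cases "m \<le> n")
      case True
      then obtain q where "q \<in> C n" "q \<subseteq> p"
        using co_bijective_C x by blast
      then show ?thesis
        using x True by (auto simp: r_iff)
    next
      case False
      then obtain q where "q \<in> C n" "p \<subseteq> q"
        using refines[of p m n] x by auto
      then show ?thesis
        using x False by (auto simp: r_iff)
    qed
  qed
  then show ?thesis
    using finite_C by (auto simp: band_def P_iff)
qed

text \<open>Caps are the sets refined by a whole level: a level beyond a given band can only be
  comparable to it from below.\<close>

lemma cap_iff: "cap P r B \<longleftrightarrow> B \<subseteq> P \<and> (\<exists>n. \<forall>q\<in>C n. \<exists>b\<in>B. ((n, enc q), b) \<in> r)"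
proof
  assume "cap P r B"
  then obtain B' where B: "B \<subseteq> P" "band P r B'" "\<forall>b\<in>B'. \<exists>c\<in>B. (b, c) \<in> r"
    by (auto simp: cap_def)
  have tr: "trans r"
    using induced_order_partial_order[OF B_sequence]
    by (simp add: partial_order_on_def preorder_on_def)
  \<comment> \<open>\<open>Suc\<close> puts level \<open>n\<close> strictly past the band, which
    rules out that a band element is below a vertex of level \<open>n\<close>;
    \<open>insert 0\<close> spares the proof that the band is non-empty.\<close>
  define n where "n = Suc (Max (insert 0 (fst ` B')))"
  have lev: "fst b < n" if "b \<in> B'" for b
    using that B(2) unfolding n_def band_def by (simp add: less_Suc_eq_le)
  have "\<exists>b\<in>B. ((n, enc q), b) \<in> r" if q: "q \<in> C n" for q
  proof -
    have "(n, enc q) \<in> P"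
      using q by (auto simp: P_iff)
    then obtain b where b: "b \<in> B'" "((n, enc q), b) \<in> r \<or> (b, (n, enc q)) \<in> r"
      using B by (auto simp: band_def)
    moreover have "(b, (n, enc q)) \<notin> r"
      using lev[OF b(1)] by (auto simp: induced_order_def)
    ultimately show ?thesis
      using B(3) tr by (meson transD)
  qed
  then show "B \<subseteq> P \<and> (\<exists>n. \<forall>q\<in>C n. \<exists>b\<in>B. ((n, enc q), b) \<in> r)"
    using B by blast
next
  assume "B \<subseteq> P \<and> (\<exists>n. \<forall>q\<in>C n. \<exists>b\<in>B. ((n, enc q), b) \<in> r)"
  then show "cap P r B"
    using band_level by (fastforce simp: cap_def)
qed

section \<open>Points as minimal selectors\<close>

definition point_sel :: "'a \<Rightarrow> (nat \<times> nat) set" where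
  "point_sel x = {(n, enc p) | n p. p \<in> C n \<and> x \<in> p}"

lemma point_sel_iff [simp]: "p \<in> C n \<Longrightarrow> (n, enc p) \<in> point_sel x \<longleftrightarrow> x \<in> p"
  by (auto simp: point_sel_def)

lemma point_sel_sub: "point_sel x \<subseteq> P"
  by (auto simp: point_sel_def P_iff)

text \<open>At the level refining the cap, some \<open>q\<close> contains \<open>x\<close>, and so
  does the element of the cap above \<open>q\<close>.\<close>

lemma selector_point_sel: assumes "x \<in> topspace X" shows "selector P r (point_sel x)"
  unfolding selector_def
proof (intro conjI allI impI point_sel_sub)
  fix B assume "cap P r B"
  then obtain n where n: "\<forall>q\<in>C n. \<exists>b\<in>B. ((n, enc q), b) \<in> r"
    by (auto simp: cap_iff)
  obtain q where q: "q \<in> C n" "x \<in> q"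
    using fine_nbhd assms by blast
  then obtain b where b: "b \<in> B" "((n, enc q), b) \<in> r"
    using n by blast
  from b(2) have "b \<in> point_sel x"
    by (rule r_E) (use q in auto)
  then show "point_sel x \<inter> B \<noteq> {}"
    using b by blast
qed

lemma point_sel_minimal:
  assumes "x \<in> topspace X" "selector P r T" "T \<subseteq> point_sel x"
  shows "T = point_sel x"
proof -
  have "(n, enc p) \<in> T" if p: "p \<in> C n" "x \<in> p" for n p
  proof -
    obtain k where k: "\<And>m q. k \<le> m \<Longrightarrow> q \<in> C m \<Longrightarrow> x \<in> q \<Longrightarrow> q \<subseteq> p"
      using eventually_sub[OF open_C[OF p(1)] p(2)] by blast
    \<comment> \<open>\<open>m\<close> is at least \<open>k\<close>, so that sets through
      \<open>x\<close> at level \<open>m\<close> lie in \<open>p\<close>, and at least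
      \<open>n\<close>, as the order demands. The cap \<open>B\<close> then meets
      \<open>point_sel x\<close> in \<open>(n, enc p)\<close> only, which forces this vertex into
      \<open>T\<close>.\<close>
    define m where "m = max k n"
    define B where "B = insert (n, enc p) {(m, enc q) | q. q \<in> C m \<and> x \<notin> q}"
    have "\<exists>b\<in>B. ((m, enc q), b) \<in> r" if q: "q \<in> C m" for q
    proof (cases "x \<in> q")
      case True
      then have "q \<subseteq> p"
        using k[OF _ q] by (simp add: m_def)
      then have "((m, enc q), (n, enc p)) \<in> r"
        using q p by (simp add: r_iff m_def)
      then show ?thesis
        by (auto simp: B_def)
    next
      case False
      then have "(m, enc q) \<in> B" "((m, enc q), (m, enc q)) \<in> r"
        using q by (auto simp: B_def r_iff)
      then show ?thesis
        by blast
    qed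
    moreover have "B \<subseteq> P"
      using p by (auto simp: B_def P_iff)
    ultimately have "cap P r B"
      by (auto simp: cap_iff)
    then have "T \<inter> B \<noteq> {}"
      using assms by (simp add: selector_def)
    moreover have "point_sel x \<inter> B \<subseteq> {(n, enc p)}"
      by (auto simp: B_def)
    ultimately show ?thesis
      using assms(3) by blast
  qed
  then show ?thesis
    using assms(3) by (auto simp: point_sel_def)
qed

text \<open>Otherwise every point has a neighbourhood \<open>p x\<close> whose vertex is missing
  from \<open>S\<close>. By compactness finitely many of them cover the space, and their vertices
  form a cap disjoint from \<open>S\<close>.\<close>

lemma selector_contains_point_sel:
  assumes "selector P r S"
  obtains x where "x \<in> topspace X" "point_sel x \<subseteq> S"
proof (rule ccontr)
  assume "\<not> thesis"
  then have no: "\<not> point_sel x \<subseteq> S" if "x \<in> topspace X" for x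
    using that \<open>\<And>x. x \<in> topspace X \<Longrightarrow> point_sel x \<subseteq> S \<Longrightarrow> thesis\<close> by blast
  then have "\<forall>x\<in>topspace X. \<exists>n p. p \<in> C n \<and> x \<in> p \<and> (n, enc p) \<notin> S"
    by (fastforce simp: point_sel_def)
  then obtain lev p where p: "\<And>x. x \<in> topspace X \<Longrightarrow>
      p x \<in> C (lev x) \<and> x \<in> p x \<and> (lev x, enc (p x)) \<notin> S"
    by metis
  then have "\<forall>U\<in>p ` topspace X. openin X U" "topspace X \<subseteq> \<Union>(p ` topspace X)"
    using open_C by blast+
  then obtain \<F> where \<F>: "finite \<F>" "\<F> \<subseteq> p ` topspace X" "topspace X \<subseteq> \<Union>\<F>"
    using compact unfolding compact_space_alt by meson
  then obtain F where F: "finite F" "F \<subseteq> topspace X" "\<F> = p ` F"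
    by (meson finite_subset_image)
  \<comment> \<open>Strictly beyond all levels used, so that each \<open>p x\<close> with
    \<open>x\<close> in \<open>F\<close> belongs to \<open>A n\<close> and the base point of
    \<open>q\<close> decides whether \<open>q\<close> lies in it.\<close>
  define n where "n = Suc (Max (insert 0 (lev ` F)))"
  have lev: "lev x < n" if "x \<in> F" for x
    using that F(1) unfolding n_def by (simp add: less_Suc_eq_le)
  define B where "B = (\<lambda>x. (lev x, enc (p x))) ` F"
  have "\<exists>b\<in>B. ((n, enc q), b) \<in> r" if q: "q \<in> C n" for q
  proof -
    obtain y where y: "y \<in> q" "\<forall>a\<in>A n. y \<in> a \<longrightarrow> q \<subseteq> a"
      using base_point q by blast
    have "y \<in> topspace X"
      using y(1) C_sub_topspace[OF q] by blast
    then obtain x where x: "x \<in> F" "y \<in> p x"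
      using F(3) \<F>(3) by blast
    have px: "p x \<in> C (lev x)"
      using p x(1) F(2) by blast
    then have "q \<subseteq> p x"
      using C_sub_A[OF lev[OF x(1)]] x(2) y(2) by blast
    then have "((n, enc q), (lev x, enc (p x))) \<in> r"
      using lev[OF x(1)] q px by (simp add: r_iff)
    then show ?thesis
      using x by (auto simp: B_def)
  qed
  moreover have "B \<subseteq> P"
    using p F(2) unfolding B_def by (intro image_subsetI) (use P_iff in blast)
  ultimately have "cap P r B"
    by (auto simp: cap_iff)
  then have "S \<inter> B \<noteq> {}"
    using assms by (simp add: selector_def)
  then show False
    using p F by (auto simp: B_def)
qed

lemma minimal_selectors_eq: "minimal_selectors P r = point_sel ` topspace X"
proof
  show "minimal_selectors P r \<subseteq> point_sel ` topspace X"
  proof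
    fix S assume S: "S \<in> minimal_selectors P r"
    then obtain x where "x \<in> topspace X" "point_sel x \<subseteq> S"
      using selector_contains_point_sel by (auto simp: minimal_selectors_def)
    then show "S \<in> point_sel ` topspace X"
      using S selector_point_sel by (auto simp: minimal_selectors_def)
  qed
  show "point_sel ` topspace X \<subseteq> minimal_selectors P r"
    using selector_point_sel point_sel_minimal by (auto simp: minimal_selectors_def)
qed

text \<open>T1 gives an open \<open>U\<close> around \<open>x\<close> missing \<open>y\<close>; a
  late member through \<open>x\<close> lies in \<open>U\<close> and so separates the two
  selectors.\<close>

lemma inj_point_sel: "inj_on point_sel (topspace X)"
proof (rule inj_onI, rule ccontr)
  fix x y assume xy: "x \<in> topspace X" "y \<in> topspace X" "point_sel x = point_sel y" "x \<noteq> y"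
  then obtain U where "openin X U" "x \<in> U" "y \<notin> U"
    using t1 unfolding t1_space_def by blast
  then obtain k where k: "\<And>n q. k \<le> n \<Longrightarrow> q \<in> C n \<Longrightarrow> x \<in> q \<Longrightarrow> q \<subseteq> U"
    using eventually_sub by blast
  obtain q where "q \<in> C k" "x \<in> q"
    using fine_nbhd xy by blast
  then show False
    using k[of k q] \<open>y \<notin> U\<close> xy(3) point_sel_iff by blast
qed

section \<open>The homeomorphism onto the spectrum\<close>

lemma spectrum_nhd_eq:
  assumes "p \<in> C n" shows "spectrum_nhd P r (n, enc p) = point_sel ` p"
  using assms C_sub_topspace[OF assms] by (auto simp: spectrum_nhd_def minimal_selectors_eq)

lemma homeomorphic_map_point_sel: "homeomorphic_map X (sequence_spectrum G R) point_sel"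
proof (rule bijective_open_imp_homeomorphic_map)
  have vim: "point_sel -` (point_sel ` U) \<inter> topspace X = U" if "U \<subseteq> topspace X" for U
    using inj_point_sel that by (auto simp: inj_on_def)
  show "continuous_map X (sequence_spectrum G R) point_sel"
    unfolding sequence_spectrum_def spectrum_def
  proof (rule continuous_on_generated_topo)
    fix U assume "U \<in> insert (minimal_selectors P r) (spectrum_nhd P r ` P)"
    then consider "U = point_sel ` topspace X" | n p where "p \<in> C n" "U = point_sel ` p"
      by (auto simp: minimal_selectors_eq P_iff spectrum_nhd_eq)
    then show "openin X (point_sel -` U \<inter> topspace X)"
      by cases (simp_all add: vim C_sub_topspace open_C)
  qed (auto simp: minimal_selectors_eq)
  show "open_map X (sequence_spectrum G R) point_sel"
    unfolding open_map_def
  proof (intro allI impI)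
    fix U assume U: "openin X U"
    \<comment> \<open>By \<open>eventually_sub\<close>, a late \<open>q\<close> through
      \<open>x\<close> lies in \<open>U\<close>; its generating set is the image of
      \<open>q\<close>.\<close>
    have "\<exists>T. openin (sequence_spectrum G R) T \<and> point_sel x \<in> T \<and> T \<subseteq> point_sel ` U"
      if x: "x \<in> U" for x
    proof -
      obtain k where k: "\<And>n q. k \<le> n \<Longrightarrow> q \<in> C n \<Longrightarrow> x \<in> q \<Longrightarrow> q \<subseteq> U"
        using eventually_sub[OF U x] by blast
      obtain q where q: "q \<in> C k" "x \<in> q"
        using fine_nbhd x openin_subset[OF U] by blast
      have "openin (sequence_spectrum G R) (spectrum_nhd P r (k, enc q))"
        unfolding sequence_spectrum_def spectrum_def
        using q by (intro topology_generated_by_Basis) (auto simp: P_iff)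
      then show ?thesis
        using q k[of k q] by (auto simp: spectrum_nhd_eq)
    qed
    then show "openin (sequence_spectrum G R) (point_sel ` U)"
      by (subst openin_subopen) blast
  qed
  show "point_sel ` topspace X = topspace (sequence_spectrum G R)"
    by (simp add: sequence_spectrum_def topspace_spectrum minimal_selectors_eq)
qed (rule inj_point_sel)

end


section \<open>Construction of fine covers\<close>

text \<open>\<open>E\<close> enumerates all finite subfamilies of a countable base, so not every
  \<open>E n\<close> is a cover.\<close>

lemma countable_cofinal_covers:
  fixes X :: "'a topology"
  assumes "second_countable X" "compact_space X" "t1_space X"
  shows "\<exists>E :: nat \<Rightarrow> 'a set set. (\<forall>n. finite (E n)) \<and> (\<forall>n. \<forall>e\<in>E n. openin X e) \<and>
    (\<forall>U x. openin X U \<longrightarrow> x \<in> U \<longrightarrow>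
       (\<exists>n. topspace X \<subseteq> \<Union>(E n) \<and> (\<forall>e\<in>E n. x \<in> e \<longrightarrow> e \<subseteq> U)))"
proof -
  obtain \<B> where \<B>: "countable \<B>" "\<And>V. V \<in> \<B> \<Longrightarrow> openin X V"
    "\<And>U x. openin X U \<Longrightarrow> x \<in> U \<Longrightarrow> \<exists>V\<in>\<B>. x \<in> V \<and> V \<subseteq> U"
    using assms(1) unfolding second_countable_def by metis
  define E where "E = from_nat_into {\<F>. finite \<F> \<and> \<F> \<subseteq> \<B>}"
  have "{} \<in> {\<F>. finite \<F> \<and> \<F> \<subseteq> \<B>}"
    by simp
  then have "E n \<in> {\<F>. finite \<F> \<and> \<F> \<subseteq> \<B>}" for n
    unfolding E_def by (intro from_nat_into) blast
  then have E: "finite (E n)" "E n \<subseteq> \<B>" for n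
    by auto
  have "countable {\<F>. finite \<F> \<and> \<F> \<subseteq> \<B>}"
    using \<B>(1) by (rule countable_Collect_finite_subset)
  then have surj: "\<exists>n. E n = \<F>" if "finite \<F>" "\<F> \<subseteq> \<B>" for \<F>
    unfolding E_def using that by (intro from_nat_into_surj) auto
  show ?thesis
  proof (intro exI[of _ E] conjI allI impI ballI)
    fix U x assume U: "openin X U" "x \<in> U"
    then have "closedin X {x}"
      using assms(3) openin_subset unfolding t1_space_closedin_singleton by blast
    then have opn: "openin X (topspace X - {x})"
      by blast
    \<comment> \<open>By T1 the complement of \<open>x\<close> is open, so these basic sets cover
      the space, and those containing \<open>x\<close> lie in \<open>U\<close>. A finite subcover is
      some \<open>E n\<close>.\<close>
    define \<V> where "\<V> = {V \<in> \<B>. V \<subseteq> U \<or> V \<subseteq> topspace X - {x}}"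
    have "topspace X \<subseteq> \<Union>\<V>"
    proof
      fix y assume "y \<in> topspace X"
      then have "y \<in> U \<or> y \<in> topspace X - {x}"
        using U by blast
      then obtain V where "V \<in> \<B>" "y \<in> V" "V \<subseteq> U \<or> V \<subseteq> topspace X - {x}"
        using \<B>(3)[OF U(1), of y] \<B>(3)[OF opn, of y] by blast
      then show "y \<in> \<Union>\<V>"
        by (auto simp: \<V>_def)
    qed
    moreover have "\<forall>V\<in>\<V>. openin X V"
      using \<B>(2) by (simp add: \<V>_def)
    ultimately obtain \<F> where \<F>: "finite \<F>" "\<F> \<subseteq> \<V>" "topspace X \<subseteq> \<Union>\<F>"
      using assms(2) unfolding compact_space_alt by meson
    then obtain n where "E n = \<F>"
      using surj[of \<F>] by (auto simp: \<V>_def)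
    then show "\<exists>n. topspace X \<subseteq> \<Union>(E n) \<and> (\<forall>e\<in>E n. x \<in> e \<longrightarrow> e \<subseteq> U)"
      using \<F> by (auto simp: \<V>_def)
  qed (use E \<B>(2) in blast)+
qed

lemma fine_covers_exist:
  fixes X :: "'a topology"
  assumes "topspace X \<noteq> {}" "second_countable X" "compact_space X" "t1_space X"
  shows "\<exists>A C. fine_covers X A C \<and>
    (Hausdorff_space X \<longrightarrow> (\<forall>n. \<exists>D\<subseteq>A (Suc n). topspace X \<subseteq> \<Union>D \<and>
      (\<forall>d\<in>D. \<exists>u\<in>C n. \<forall>d'\<in>D. d \<inter> d' \<noteq> {} \<longrightarrow> d' \<subseteq> u)))"
proof -
  obtain E :: "nat \<Rightarrow> 'a set set" where E: "\<forall>n. finite (E n)" "\<forall>n. \<forall>e\<in>E n. openin X e"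
    "\<forall>U x. openin X U \<longrightarrow> x \<in> U \<longrightarrow>
       (\<exists>n. topspace X \<subseteq> \<Union>(E n) \<and> (\<forall>e\<in>E n. x \<in> e \<longrightarrow> e \<subseteq> U))"
    using countable_cofinal_covers[OF assms(2-4)] by (elim exE conjE) (rule that)
  define good where "good A \<longleftrightarrow> finite A \<and> (\<forall>a\<in>A. openin X a)" for A
  \<comment> \<open>The guard \<open>good A\<close> makes the choice total, so that \<open>c\<close>
    can be used in a recursion before \<open>good\<close> is known along it.\<close>
  have "\<forall>A. \<exists>C. good A \<longrightarrow> fine_family X A C"
    using fine_family_exists[OF assms(4)] good_def by metis
  then obtain c where c: "\<And>A. good A \<Longrightarrow> fine_family X A (c A)"
    by metis
  have "\<exists>D. good D \<and> (Hausdorff_space X \<and> fine_family X A C \<longrightarrow> topspace X \<subseteq> \<Union>D \<and>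
      (\<forall>d\<in>D. \<exists>u\<in>C. \<forall>d'\<in>D. d \<inter> d' \<noteq> {} \<longrightarrow> d' \<subseteq> u))" for A C
  proof (cases "Hausdorff_space X \<and> fine_family X A C")
    case True
    then have reg: "regular_space X"
      using assms(3) compact_Hausdorff_imp_regular_space by blast
    have openC: "openin X u" if "u \<in> C" for u
      using True that by (simp add: fine_family_def)
    have "\<forall>y\<in>topspace X. \<exists>q\<in>C. y \<in> q \<and> (\<forall>a\<in>A. y \<in> a \<longrightarrow> q \<subseteq> a)"
      using True by (simp add: fine_family_def)
    then have coverC: "topspace X \<subseteq> \<Union>C"
      by blast
    show ?thesis
    proof (rule star_refinement[OF assms(3) reg assms(1) openC coverC])
      fix D assume "finite D" "\<And>d. d \<in> D \<Longrightarrow> openin X d" "topspace X \<subseteq> \<Union>D"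
        "\<And>d. d \<in> D \<Longrightarrow> \<exists>u\<in>C. \<forall>d'\<in>D. d \<inter> d' \<noteq> {} \<longrightarrow> d' \<subseteq> u"
      then show ?thesis
        unfolding good_def by (intro exI[of _ D]) simp
    qed
  next
    case False
    \<comment> \<open>The empty family is a dummy where no star refinement is required.\<close>
    have "good {}"
      by (simp add: good_def)
    then show ?thesis
      using False by blast
  qed
  then obtain D where D: "\<And>A C. good (D A C)"
    "\<And>A C. Hausdorff_space X \<Longrightarrow> fine_family X A C \<Longrightarrow> topspace X \<subseteq> \<Union>(D A C) \<and>
      (\<forall>d\<in>D A C. \<exists>u\<in>C. \<forall>d'\<in>D A C. d \<inter> d' \<noteq> {} \<longrightarrow> d' \<subseteq> u)"
    by metis
  \<comment> \<open>Each step adds the cover \<open>c (A n)\<close> just built, the next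
    \<open>E n\<close>, and a star refinement of that cover; the cover at level \<open>n\<close> is
    \<open>c (A n)\<close>.\<close>
  define A where "A = rec_nat {} (\<lambda>n A. A \<union> c A \<union> E n \<union> D A (c A))"
  have A_Suc: "A (Suc n) = A n \<union> c (A n) \<union> E n \<union> D (A n) (c (A n))" for n
    by (simp add: A_def)
  have good: "good (A n)" for n
  proof (induction n)
    case (Suc n)
    have "good (c (A n))"
      using c[OF Suc] by (simp add: fine_family_def good_def)
    then show ?case
      using Suc D(1)[of "A n" "c (A n)"] E unfolding A_Suc by (auto simp: good_def)
  qed (simp add: A_def good_def)
  show ?thesis
  proof (rule exI[of _ A], rule exI[of _ "\<lambda>n. c (A n)"], intro conjI impI allI)
    show "fine_covers X A (\<lambda>n. c (A n))"
    proof
      fix U x assume "openin X U" "x \<in> U"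
      then obtain n where "topspace X \<subseteq> \<Union>(E n) \<and> (\<forall>e\<in>E n. x \<in> e \<longrightarrow> e \<subseteq> U)"
        using E(3) by blast
      moreover have "E n \<subseteq> A (Suc n)"
        by (auto simp: A_Suc)
      ultimately show "\<exists>n. \<exists>E\<subseteq>A n. topspace X \<subseteq> \<Union>E \<and> (\<forall>e\<in>E. x \<in> e \<longrightarrow> e \<subseteq> U)"
        by (intro exI[of _ "Suc n"] exI[of _ "E n"]) simp
    qed (use assms c good in \<open>auto simp: A_Suc\<close>)
    fix n assume "Hausdorff_space X"
    moreover have "D (A n) (c (A n)) \<subseteq> A (Suc n)"
      by (auto simp: A_Suc)
    ultimately show "\<exists>D\<subseteq>A (Suc n). topspace X \<subseteq> \<Union>D \<and>
        (\<forall>d\<in>D. \<exists>u\<in>c (A n). \<forall>d'\<in>D. d \<inter> d' \<noteq> {} \<longrightarrow> d' \<subseteq> u)"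
      using D(2)[OF _ c[OF good[of n]]]
      by (intro exI[of _ "D (A n) (c (A n))"]) simp
  qed
qed

theorem proposition4p20:
  fixes X :: "'a topology"
  assumes "topspace X \<noteq> {}"
    and "second_countable X"
    and "compact_space X"
    and "t1_space X"
  shows "\<exists>(G :: nat \<Rightarrow> nat graph) (R :: nat \<Rightarrow> nat \<Rightarrow> nat rel).
           B_sequence G R \<and> edge_witnessing_seq G R \<and>
           X homeomorphic_space sequence_spectrum G R \<and>
           (perfect_topology X \<longrightarrow> anti_injective_seq G R) \<and>
           (Hausdorff_space X \<longrightarrow> star_refining_seq G R)"
proof -
  obtain A C where AC: "fine_covers X A C"
    and star: "Hausdorff_space X \<longrightarrow> (\<forall>n. \<exists>D\<subseteq>A (Suc n). topspace X \<subseteq> \<Union>D \<and>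
      (\<forall>d\<in>D. \<exists>u\<in>C n. \<forall>d'\<in>D. d \<inter> d' \<noteq> {} \<longrightarrow> d' \<subseteq> u))"
    using fine_covers_exist[OF assms] by (elim exE conjE) (rule that)
  interpret fine_covers X A C
    by (rule AC)
  have "X homeomorphic_space sequence_spectrum G R"
    using homeomorphic_map_point_sel homeomorphic_map_imp_homeomorphic_space by blast
  moreover have "star_refining_seq G R" if "Hausdorff_space X"
    using star that by (intro star_refining_seq) simp
  ultimately show ?thesis
    using B_sequence edge_witnessing_seq anti_injective_seq by metis
qed

end
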